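(* Let $R$ be a ring, let $(E,d_E)$ be a Euclidean $R$-bimodule and let $0\neq A=(a_{ij})\in M_{m,n}(E,\ldots,E)$ where $m,n\ge 2$. Then $A\approx_b B$ (row-column equivalence) for some $m\times n$ matrix $B$ with entries $b_{11},b_{22},\ldots,b_{ss}$ in the positions $(1,1),\ldots,(s,s)$ and zeros elsewhere, where $N_b(A)=Rb_{11}R\supseteq Rb_{22}R\supseteq\cdots\supseteq Rb_{ss}R\neq\{0\}$.
   Context: Rings are unital. A poset is Artinian if every descending chain in it stabilizes. A left $R$-module $E$ is Euclidean with Euclidean function $d_E:E\setminus\{0\}\to P$, $P$ a poset, if $\mathrm{im}(d_E)$ is an Artinian poset and, for any nonzero $u,v\in E$, there are $q\in R$, $r\in E$ with $u=qv+r$ and either $r=0$ or $d_E(r)<d_E(v)$. Right Euclidean modules are defined in the same way with $u=vq+r$. An $R$-bimodule $(E,d_E)$ is a Euclidean $R$-bimodule if both the left module $({}_RE,d_E)$ and the right module $(E_R,d_E)$ are Euclidean (with the same function $d_E$). For $a\in E$, $RaR$ is the sub-bimodule generated by $a$. For a matrix $A=(a_{ij})$ over $E$, $N_b(A):=\sum_{i,j}Ra_{ij}R$. $M_{m,n}(E,\ldots,E)$ is the set of $m\times n$ matrices with entries in $E$. With $a_1,\ldots,a_m$ the rows and $c_1,\ldots,c_n$ the columns, the elementary operations are: (ER1) $a_i\mapsto a_i+\sum_{j\neq i}r_ja_j$, $r_j\in R$; (ER2) swapping two rows; (EC1) $c_i\mapsto c_i+\sum_{j\neq i}c_jr_j$,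 $r_j\in R$ (scalars on the right); (EC2) swapping two columns. $A\approx_bA'$ (row-column equivalent) means one matrix is obtained from the other by finitely many operations (ER1), (ER2), (EC1), (EC2). *)

theory Defs
  imports
    "HOL-Library.Set_Algebras"
    "Jordan_Normal_Form.Column_Operations"
begin

text \<open>
  The sort \<open>{ring, monoid_mult}\<close> is that of (not necessarily commutative) unital rings;
  unlike \<open>ring_1\<close> it does not exclude the zero ring.
\<close>

locale left_module =
  fixes lscale :: "'r::{ring,monoid_mult} \<Rightarrow> 'e::ab_group_add \<Rightarrow> 'e"
  assumes lscale_right_distrib: "lscale a (x + y) = lscale a x + lscale a y"
    and lscale_left_distrib: "lscale (a + b) x = lscale a x + lscale b x"
    and lscale_lscale: "lscale a (lscale b x) = lscale (a * b) x"
    and lscale_one: "lscale 1 x = x"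

locale right_module =
  fixes rscale :: "'e::ab_group_add \<Rightarrow> 'r::{ring,monoid_mult} \<Rightarrow> 'e"
  assumes rscale_left_distrib: "rscale (x + y) a = rscale x a + rscale y a"
    and rscale_right_distrib: "rscale x (a + b) = rscale x a + rscale x b"
    and rscale_rscale: "rscale (rscale x a) b = rscale x (a * b)"
    and rscale_one: "rscale x 1 = x"

locale bimodule = left_module lscale + right_module rscale
  for lscale :: "'r::{ring,monoid_mult} \<Rightarrow> 'e::ab_group_add \<Rightarrow> 'e"
    and rscale :: "'e \<Rightarrow> 'r \<Rightarrow> 'e" +
  assumes lscale_rscale: "rscale (lscale a x) b = lscale a (rscale x b)"

definition artinian_on :: "'p::order set \<Rightarrow> bool" where
  "artinian_on S \<longleftrightarrow>
    (\<forall>f::nat \<Rightarrow> 'p. range f \<subseteq> S \<and> decseq f \<longrightarrow> (\<exists>N. \<forall>n\<ge>N. f n = f N))"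

text \<open>
  The Euclidean function is defined on the nonzero elements only. It is represented by a total
  function \<open>d\<close> whose value at \<open>0\<close> is never used.
\<close>

locale euclidean_left_module = left_module lscale
  for lscale :: "'r::{ring,monoid_mult} \<Rightarrow> 'e::ab_group_add \<Rightarrow> 'e" +
  fixes d :: "'e \<Rightarrow> 'p::order"
  assumes artinian_left: "artinian_on (d ` (- {0}))"
    and division_left:
      "u \<noteq> 0 \<Longrightarrow> v \<noteq> 0 \<Longrightarrow> \<exists>q r. u = lscale q v + r \<and> (r = 0 \<or> d r < d v)"

locale euclidean_right_module = right_module rscale
  for rscale :: "'e::ab_group_add \<Rightarrow> 'r::{ring,monoid_mult} \<Rightarrow> 'e" +
  fixes d :: "'e \<Rightarrow> 'p::order"
  assumes artinian_right: "artinian_on (d ` (- {0}))"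
    and division_right:
      "u \<noteq> 0 \<Longrightarrow> v \<noteq> 0 \<Longrightarrow> \<exists>q r. u = rscale v q + r \<and> (r = 0 \<or> d r < d v)"

locale euclidean_bimodule =
  bimodule lscale rscale + euclidean_left_module lscale d + euclidean_right_module rscale d
  for lscale :: "'r::{ring,monoid_mult} \<Rightarrow> 'e::ab_group_add \<Rightarrow> 'e"
    and rscale :: "'e \<Rightarrow> 'r \<Rightarrow> 'e"
    and d :: "'e \<Rightarrow> 'p::order"

text \<open>Closure under negation follows from the scalar \<open>- 1\<close>.\<close>

definition subbimodule ::
    "('r \<Rightarrow> 'e \<Rightarrow> 'e) \<Rightarrow> ('e \<Rightarrow> 'r \<Rightarrow> 'e) \<Rightarrow> 'e::ab_group_add set \<Rightarrow> bool" where
  "subbimodule lscale rscale S \<longleftrightarrow>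
    0 \<in> S \<and> (\<forall>x\<in>S. \<forall>y\<in>S. x + y \<in> S) \<and>
    (\<forall>a. \<forall>x\<in>S. lscale a x \<in> S) \<and> (\<forall>a. \<forall>x\<in>S. rscale x a \<in> S)"

text \<open>\<open>RaR\<close>, the sub-bimodule generated by \<open>a\<close>.\<close>

definition bispan ::
    "('r \<Rightarrow> 'e \<Rightarrow> 'e) \<Rightarrow> ('e \<Rightarrow> 'r \<Rightarrow> 'e) \<Rightarrow> 'e::ab_group_add \<Rightarrow> 'e set" where
  "bispan lscale rscale a = subbimodule lscale rscale hull {a}"

text \<open>The sum below is the elementwise (Minkowski) sum of sets.\<close>

definition Nb ::
    "('r \<Rightarrow> 'e \<Rightarrow> 'e) \<Rightarrow> ('e \<Rightarrow> 'r \<Rightarrow> 'e) \<Rightarrow> 'e::ab_group_add mat \<Rightarrow> 'e set" where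
  "Nb lscale rscale A =
    (\<Sum>(i,j)\<in>{..<dim_row A} \<times> {..<dim_col A}. bispan lscale rscale (A $$ (i,j)))"

definition add_to_row ::
    "('r \<Rightarrow> 'e \<Rightarrow> 'e) \<Rightarrow> nat \<Rightarrow> (nat \<Rightarrow> 'r) \<Rightarrow> 'e::ab_group_add mat \<Rightarrow> 'e mat" where
  "add_to_row lscale k r A = mat (dim_row A) (dim_col A) (\<lambda>(i,j).
    if i = k then A $$ (k,j) + (\<Sum>l\<in>{..<dim_row A} - {k}. lscale (r l) (A $$ (l,j)))
    else A $$ (i,j))"

definition add_to_col ::
    "('e \<Rightarrow> 'r \<Rightarrow> 'e) \<Rightarrow> nat \<Rightarrow> (nat \<Rightarrow> 'r) \<Rightarrow> 'e::ab_group_add mat \<Rightarrow> 'e mat" where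
  "add_to_col rscale k r A = mat (dim_row A) (dim_col A) (\<lambda>(i,j).
    if j = k then A $$ (i,k) + (\<Sum>l\<in>{..<dim_col A} - {k}. rscale (A $$ (i,l)) (r l))
    else A $$ (i,j))"

inductive elementary_step ::
    "('r \<Rightarrow> 'e \<Rightarrow> 'e) \<Rightarrow> ('e \<Rightarrow> 'r \<Rightarrow> 'e) \<Rightarrow> 'e::ab_group_add mat \<Rightarrow> 'e mat \<Rightarrow> bool"
  for lscale rscale where
    ER1: "k < dim_row A \<Longrightarrow> elementary_step lscale rscale A (add_to_row lscale k r A)"
  | ER2: "k < dim_row A \<Longrightarrow> l < dim_row A \<Longrightarrow> k \<noteq> l \<Longrightarrow>
      elementary_step lscale rscale A (swaprows k l A)"
  | EC1: "k < dim_col A \<Longrightarrow> elementary_step lscale rscale A (add_to_col rscale k r A)"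
  | EC2: "k < dim_col A \<Longrightarrow> l < dim_col A \<Longrightarrow> k \<noteq> l \<Longrightarrow>
      elementary_step lscale rscale A (swapcols k l A)"

text \<open>
  Over a bimodule every elementary step is undone by a step of the same kind, so this relation
  is symmetric there.
\<close>

definition row_col_equiv ::
    "('r \<Rightarrow> 'e \<Rightarrow> 'e) \<Rightarrow> ('e \<Rightarrow> 'r \<Rightarrow> 'e) \<Rightarrow> 'e::ab_group_add mat \<Rightarrow> 'e mat \<Rightarrow> bool" where
  "row_col_equiv lscale rscale = (elementary_step lscale rscale)\<^sup>*\<^sup>*"

end

theory Submission
  imports Defs
begin

text \<open>
  Among all nonzero entries of all matrices equivalent to \<open>A\<close>, choose one, \<open>b\<close>, of minimal
  Euclidean value and move it to the top left corner. By minimality every division by \<open>b\<close> within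
  its row or its column has remainder \<open>0\<close>, so the first row and column can be cleared. Adding any
  other row to the first one then leaves \<open>b\<close> in place, so every remaining entry is a right
  multiple of \<open>b\<close>. Hence \<open>RbR\<close> contains all entries, and one recurses on the remaining block,
  whose entries stay in \<open>RbR\<close> under all later operations.
\<close>

section \<open>Minimal elements from the Artinian condition, and scalar arithmetic\<close>

lemma artinian_on_minimal:
  fixes f :: "'a \<Rightarrow> 'p::order"
  assumes "artinian_on (f ` S)" and "X \<subseteq> S" and "X \<noteq> {}"
  shows "\<exists>x\<in>X. \<forall>y\<in>X. \<not> f y < f x"
proof (rule ccontr)
  assume "\<not> ?thesis"
  then obtain g where g: "\<And>x. x \<in> X \<Longrightarrow> g x \<in> X \<and> f (g x) < f x" by metis
  obtain x0 where x0: "x0 \<in> X" using assms(3) by blast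
  \<comment> \<open>Iterating the choice of an element with smaller value gives a strictly
    descending sequence of values, which can never stabilize.\<close>
  define h where "h n = (g ^^ n) x0" for n
  have h: "h n \<in> X" for n
    by (induction n) (use x0 g in \<open>auto simp: h_def\<close>)
  have dec: "f (h (Suc n)) < f (h n)" for n
    using g[OF h[of n]] by (simp add: h_def)
  have "range (\<lambda>n. f (h n)) \<subseteq> f ` S" using h assms(2) by blast
  moreover have "decseq (\<lambda>n. f (h n))"
    by (rule decseq_SucI) (use dec in \<open>simp add: less_imp_le\<close>)
  ultimately obtain N where "\<forall>n\<ge>N. f (h n) = f (h N)"
    using assms(1) unfolding artinian_on_def by blast
  then show False using dec[of N] by (metis le_SucI less_irrefl order_refl)
qed

lemma (in left_module) lscale_zero_right [simp]: "lscale a 0 = 0"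
  using lscale_right_distrib[of a 0 0] by simp

lemma (in left_module) lscale_zero_left [simp]: "lscale 0 x = 0"
  using lscale_left_distrib[of 0 0 x] by simp

lemma (in left_module) lscale_minus_left: "lscale (- a) x = - lscale a x"
  using lscale_left_distrib[of "- a" a x] by (simp add: eq_neg_iff_add_eq_0)

lemma (in right_module) rscale_zero_left [simp]: "rscale 0 a = 0"
  using rscale_left_distrib[of 0 0 a] by simp

lemma (in right_module) rscale_zero_right [simp]: "rscale x 0 = 0"
  using rscale_right_distrib[of x 0 0] by simp

lemma (in right_module) rscale_minus_right: "rscale x (- a) = - rscale x a"
  using rscale_right_distrib[of x "- a" a] by (simp add: eq_neg_iff_add_eq_0)

subsection \<open>Sub-bimodules\<close>

context bimodule
begin

lemma subbimodule_zero: "subbimodule lscale rscale S \<Longrightarrow> 0 \<in> S"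
  and subbimodule_add: "subbimodule lscale rscale S \<Longrightarrow> x \<in> S \<Longrightarrow> y \<in> S \<Longrightarrow> x + y \<in> S"
  and subbimodule_lscale: "subbimodule lscale rscale S \<Longrightarrow> x \<in> S \<Longrightarrow> lscale a x \<in> S"
  and subbimodule_rscale: "subbimodule lscale rscale S \<Longrightarrow> x \<in> S \<Longrightarrow> rscale x a \<in> S"
  by (auto simp: subbimodule_def)

text \<open>Negatives come from the scalar \<open>- 1\<close>. The equivalence lets row and column
  additions be treated in both directions at once, without inverse operations.\<close>

lemma subbimodule_add_iff:
  assumes "subbimodule lscale rscale S" and "y \<in> S"
  shows "x + y \<in> S \<longleftrightarrow> x \<in> S"
proof
  assume "x + y \<in> S"
  moreover have "- y \<in> S"
    using subbimodule_lscale[OF assms, of "- 1"] by (simp add: lscale_minus_left lscale_one)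
  ultimately show "x \<in> S"
    using subbimodule_add[OF assms(1), of "x + y" "- y"] by simp
qed (use assms subbimodule_add in blast)

lemma subbimodule_bispan: "subbimodule lscale rscale (bispan lscale rscale a)"
  unfolding bispan_def hull_def subbimodule_def by blast

lemma bispan_self: "a \<in> bispan lscale rscale a"
  unfolding bispan_def by (rule hull_inc) simp

lemma bispan_subset_iff:
  assumes "subbimodule lscale rscale S"
  shows "bispan lscale rscale a \<subseteq> S \<longleftrightarrow> a \<in> S"
  using bispan_self[of a] hull_minimal[of "{a}" S "subbimodule lscale rscale"] assms
  unfolding bispan_def by blast

lemma subbimodule_set_plus:
  assumes "subbimodule lscale rscale S" and "subbimodule lscale rscale T"
  shows "subbimodule lscale rscale (S + T)"
  unfolding subbimodule_def
proof (intro conjI ballI allI)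
  show "0 \<in> S + T"
    using set_plus_intro[of 0 S 0 T] assms by (simp add: subbimodule_zero)
next
  fix x y assume "x \<in> S + T" "y \<in> S + T"
  then obtain x1 x2 y1 y2 where xy: "x = x1 + x2" "y = y1 + y2"
      "x1 \<in> S" "x2 \<in> T" "y1 \<in> S" "y2 \<in> T"
    by (auto elim!: set_plus_elim)
  have "x + y = (x1 + y1) + (x2 + y2)" by (simp add: xy algebra_simps)
  then show "x + y \<in> S + T"
    using xy assms by (simp only: set_plus_intro subbimodule_add)
next
  fix a x assume "x \<in> S + T"
  then show "lscale a x \<in> S + T"
    using assms by (auto elim!: set_plus_elim simp: lscale_right_distrib
        intro!: set_plus_intro intro: subbimodule_lscale)
next
  fix a x assume "x \<in> S + T"
  then show "rscale x a \<in> S + T"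
    using assms by (auto elim!: set_plus_elim simp: rscale_left_distrib
        intro!: set_plus_intro intro: subbimodule_rscale)
qed

lemma subbimodule_sum:
  assumes "\<And>i. i \<in> I \<Longrightarrow> subbimodule lscale rscale (f i)"
  shows "subbimodule lscale rscale (sum f I)"
  using assms
proof (induction I rule: infinite_finite_induct)
  case (insert i I)
  then show ?case by (simp add: subbimodule_set_plus)
qed (simp_all add: subbimodule_def)

text \<open>The sum is the join of its summands in the lattice of sub-bimodules: each summand lies
  in it because the others contain 0, and \<open>S\<close> is closed under addition.\<close>

lemma sum_subset_subbimodule_iff:
  assumes "finite I" and "subbimodule lscale rscale S"
    and "\<And>i. i \<in> I \<Longrightarrow> subbimodule lscale rscale (f i)"
  shows "sum f I \<subseteq> S \<longleftrightarrow> (\<forall>i\<in>I. f i \<subseteq> S)"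
  using assms(1,3)
proof (induction I rule: finite_induct)
  case empty
  then show ?case using assms(2) by (simp add: subbimodule_zero)
next
  case (insert i I)
  let ?T = "sum f I"
  have T: "subbimodule lscale rscale ?T" using insert.prems by (auto intro: subbimodule_sum)
  have "f i + ?T \<subseteq> S \<longleftrightarrow> f i \<subseteq> S \<and> ?T \<subseteq> S"
  proof (intro iffI conjI subsetI)
    fix x assume "f i + ?T \<subseteq> S" "x \<in> f i"
    then show "x \<in> S" using set_plus_intro[of x "f i" 0 ?T] subbimodule_zero[OF T] by auto
  next
    fix x assume "f i + ?T \<subseteq> S" "x \<in> ?T"
    then show "x \<in> S"
      using set_plus_intro[of 0 "f i" x ?T] subbimodule_zero[OF insert.prems[of i]] by auto
  next
    fix x assume "f i \<subseteq> S \<and> ?T \<subseteq> S" "x \<in> f i + ?T"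
    then show "x \<in> S" using assms(2) by (auto elim!: set_plus_elim intro!: subbimodule_add)
  qed
  then show ?case using insert by simp
qed

lemma subbimodule_Nb: "subbimodule lscale rscale (Nb lscale rscale A)"
  unfolding Nb_def by (rule subbimodule_sum) (auto simp: subbimodule_bispan)

text \<open>Characterizes \<open>Nb\<close> by the sub-bimodules that contain it, so that the final
  equality needs no computation with sums of sets.\<close>

lemma Nb_subset_iff:
  assumes "subbimodule lscale rscale S"
  shows "Nb lscale rscale A \<subseteq> S \<longleftrightarrow> (\<forall>i<dim_row A. \<forall>j<dim_col A. A $$ (i,j) \<in> S)"
  unfolding Nb_def
  by (subst sum_subset_subbimodule_iff)
    (auto simp: assms subbimodule_bispan bispan_subset_iff)

subsection \<open>Elementary operations on the lower right block\<close>

text \<open>Invariant of the elimination after \<open>k\<close> pivots have been split off. Diagonal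
  entries are unrestricted, and \<open>k = 0\<close> imposes nothing.\<close>

definition block_from :: "nat \<Rightarrow> 'e mat \<Rightarrow> bool" where
  "block_from k A \<longleftrightarrow> (\<forall>i<dim_row A. \<forall>j<dim_col A.
    (i < k \<or> j < k) \<and> i \<noteq> j \<longrightarrow> A $$ (i,j) = 0)"

text \<open>For \<open>S = {0}\<close> the block vanishes; letting \<open>S\<close> range over the
  sub-bimodules determines the sub-bimodule generated by the entries of the block.\<close>

definition tail_subset :: "nat \<Rightarrow> 'e mat \<Rightarrow> 'e set \<Rightarrow> bool" where
  "tail_subset k A S \<longleftrightarrow> (\<forall>i j. k \<le> i \<and> i < dim_row A \<and> k \<le> j \<and> j < dim_col A \<longrightarrow> A $$ (i,j) \<in> S)"

text \<open>
  The last clause replaces invariance of \<open>N\<^sub>b\<close>, applied to the lower right block.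
\<close>

definition tail_equiv :: "nat \<Rightarrow> 'e mat \<Rightarrow> 'e mat \<Rightarrow> bool" where
  "tail_equiv k A B \<longleftrightarrow> row_col_equiv lscale rscale A B \<and>
    dim_row B = dim_row A \<and> dim_col B = dim_col A \<and>
    (\<forall>i<dim_row A. \<forall>j<dim_col A. i < k \<or> j < k \<longrightarrow> B $$ (i,j) = A $$ (i,j)) \<and>
    (\<forall>S. subbimodule lscale rscale S \<longrightarrow> tail_subset k B S = tail_subset k A S)"

lemma tail_equiv_dim:
  "tail_equiv k A B \<Longrightarrow> dim_row B = dim_row A" "tail_equiv k A B \<Longrightarrow> dim_col B = dim_col A"
  by (simp_all add: tail_equiv_def)

lemma tail_equiv_refl: "tail_equiv k A A"
  by (simp add: tail_equiv_def row_col_equiv_def)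

lemma tail_equiv_trans: "tail_equiv k A B \<Longrightarrow> tail_equiv k B C \<Longrightarrow> tail_equiv k A C"
  unfolding tail_equiv_def row_col_equiv_def by (auto intro: rtranclp_trans)

lemma tail_equiv_block_from: "tail_equiv k A B \<Longrightarrow> block_from k A \<Longrightarrow> block_from k B"
  by (auto simp: tail_equiv_def block_from_def)


text \<open>Row \<open>l\<close> belongs to the block and is unchanged. If either block has its
  entries in \<open>S\<close>, so has row \<open>l\<close>, and adding a multiple of an element of
  \<open>S\<close> does not affect membership in \<open>S\<close>.\<close>

lemma tail_subset_add_row_iff:
  assumes "subbimodule lscale rscale S" and "k \<le> l" and "l < dim_row A" and "l \<noteq> i"
    and "dim_row B = dim_row A" and "dim_col B = dim_col A"
    and "\<And>p q. p < dim_row A \<Longrightarrow> q < dim_col A \<Longrightarrow>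
      B $$ (p,q) = (if p = i then A $$ (i,q) + lscale c (A $$ (l,q)) else A $$ (p,q))"
  shows "tail_subset k B S = tail_subset k A S"
proof -
  have "B $$ (p,q) \<in> S \<longleftrightarrow> A $$ (p,q) \<in> S"
    if "p < dim_row A" "q < dim_col A" "A $$ (l,q) \<in> S" for p q
    using that assms by (simp add: subbimodule_add_iff subbimodule_lscale)
  moreover have "B $$ (l,q) = A $$ (l,q)" if "q < dim_col A" for q
    using that assms by simp
  ultimately show ?thesis
    using assms(2,3,5,6) unfolding tail_subset_def by metis
qed

lemma tail_subset_add_col_iff:
  assumes "subbimodule lscale rscale S" and "k \<le> l" and "l < dim_col A" and "l \<noteq> j"
    and "dim_row B = dim_row A" and "dim_col B = dim_col A"
    and "\<And>p q. p < dim_row A \<Longrightarrow> q < dim_col A \<Longrightarrow>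
      B $$ (p,q) = (if q = j then A $$ (p,j) + rscale (A $$ (p,l)) c else A $$ (p,q))"
  shows "tail_subset k B S = tail_subset k A S"
proof -
  have "B $$ (p,q) \<in> S \<longleftrightarrow> A $$ (p,q) \<in> S"
    if "p < dim_row A" "q < dim_col A" "A $$ (p,l) \<in> S" for p q
    using that assms by (simp add: subbimodule_add_iff subbimodule_rscale)
  moreover have "B $$ (p,l) = A $$ (p,l)" if "p < dim_row A" for p
    using that assms by simp
  ultimately show ?thesis
    using assms(2,3,5,6) unfolding tail_subset_def by metis
qed

lemma tail_equiv_add_row:
  assumes "block_from k A" and "k \<le> i" and "i < dim_row A" and "k \<le> l" and "l < dim_row A"
    and "l \<noteq> i"
  obtains B where "tail_equiv k A B" and "dim_row B = dim_row A" and "dim_col B = dim_col A"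
    and "\<And>p q. p < dim_row A \<Longrightarrow> q < dim_col A \<Longrightarrow>
      B $$ (p,q) = (if p = i then A $$ (i,q) + lscale c (A $$ (l,q)) else A $$ (p,q))"
proof -
  \<comment> \<open>A single nonzero coefficient reduces the sum in ER1 to one multiple of row
    \<open>l\<close>.\<close>
  define B where "B = add_to_row lscale i (\<lambda>x. if x = l then c else 0) A"
  have dim: "dim_row B = dim_row A" "dim_col B = dim_col A"
    by (simp_all add: B_def add_to_row_def)
  have "(\<Sum>x\<in>{..<dim_row A} - {i}. lscale (if x = l then c else 0) (A $$ (x,q)))
      = (\<Sum>x\<in>{..<dim_row A} - {i}. if x = l then lscale c (A $$ (x,q)) else 0)" for q
    by (rule sum.cong) auto
  then have index: "B $$ (p,q) = (if p = i then A $$ (i,q) + lscale c (A $$ (l,q)) else A $$ (p,q))"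
    if "p < dim_row A" "q < dim_col A" for p q
    using that assms(5,6) by (simp add: B_def add_to_row_def)
  have "row_col_equiv lscale rscale A B"
    unfolding row_col_equiv_def B_def using assms(3) by (blast intro: elementary_step.ER1)
  \<comment> \<open>In a column \<open>q < k\<close> row \<open>l\<close> has a zero, since
    \<open>q < k \<le> l\<close> is off the diagonal; rows before \<open>k\<close> are not touched
    at all.\<close>
  moreover have "B $$ (p,q) = A $$ (p,q)" if "p < dim_row A" "q < dim_col A" "p < k \<or> q < k" for p q
    using that assms by (auto simp: index block_from_def)
  moreover have "tail_subset k B S = tail_subset k A S" if "subbimodule lscale rscale S" for S
    by (rule tail_subset_add_row_iff[OF that assms(4,5,6) dim index])
  ultimately have "tail_equiv k A B" by (simp add: tail_equiv_def dim)
  then show thesis using that dim index by blast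
qed

lemma tail_equiv_add_col:
  assumes "block_from k A" and "k \<le> j" and "j < dim_col A" and "k \<le> l" and "l < dim_col A"
    and "l \<noteq> j"
  obtains B where "tail_equiv k A B" and "dim_row B = dim_row A" and "dim_col B = dim_col A"
    and "\<And>p q. p < dim_row A \<Longrightarrow> q < dim_col A \<Longrightarrow>
      B $$ (p,q) = (if q = j then A $$ (p,j) + rscale (A $$ (p,l)) c else A $$ (p,q))"
proof -
  define B where "B = add_to_col rscale j (\<lambda>x. if x = l then c else 0) A"
  have dim: "dim_row B = dim_row A" "dim_col B = dim_col A"
    by (simp_all add: B_def add_to_col_def)
  have "(\<Sum>x\<in>{..<dim_col A} - {j}. rscale (A $$ (p,x)) (if x = l then c else 0))
      = (\<Sum>x\<in>{..<dim_col A} - {j}. if x = l then rscale (A $$ (p,x)) c else 0)" for p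
    by (rule sum.cong) auto
  then have index: "B $$ (p,q) = (if q = j then A $$ (p,j) + rscale (A $$ (p,l)) c else A $$ (p,q))"
    if "p < dim_row A" "q < dim_col A" for p q
    using that assms(5,6) by (simp add: B_def add_to_col_def)
  have "row_col_equiv lscale rscale A B"
    unfolding row_col_equiv_def B_def using assms(3) by (blast intro: elementary_step.EC1)
  moreover have "B $$ (p,q) = A $$ (p,q)" if "p < dim_row A" "q < dim_col A" "p < k \<or> q < k" for p q
    using that assms by (auto simp: index block_from_def)
  moreover have "tail_subset k B S = tail_subset k A S" if "subbimodule lscale rscale S" for S
    by (rule tail_subset_add_col_iff[OF that assms(4,5,6) dim index])
  ultimately have "tail_equiv k A B" by (simp add: tail_equiv_def dim)
  then show thesis using that dim index by blast
qed

lemma tail_equiv_swaprows: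
  assumes "block_from k A" and "k \<le> i" and "i < dim_row A" and "k \<le> l" and "l < dim_row A"
  shows "tail_equiv k A (swaprows i l A)"
proof (cases "i = l")
  \<comment> \<open>ER2 requires distinct rows, so the trivial swap counts as no operation.\<close>
  case True
  then have "swaprows i l A = A" by (intro eq_matI) auto
  then show ?thesis by (simp add: tail_equiv_refl)
next
  case False
  have "row_col_equiv lscale rscale A (swaprows i l A)"
    unfolding row_col_equiv_def using assms False by (blast intro: elementary_step.ER2)
  moreover have "tail_subset k (swaprows i l A) S = tail_subset k A S" for S
  proof
    assume B: "tail_subset k (swaprows i l A) S"
    have "A $$ (p,q) \<in> S" if "k \<le> p" "p < dim_row A" "k \<le> q" "q < dim_col A" for p q
    proof -
      \<comment> \<open>\<open>p'\<close> is the row to which the swap moves row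
        \<open>p\<close>.\<close>
      define p' where "p' = (if p = i then l else if p = l then i else p)"
      have "swaprows i l A $$ (p',q) \<in> S"
        using B that assms by (simp add: tail_subset_def p'_def)
      then show ?thesis using that assms by (auto simp: p'_def split: if_splits)
    qed
    then show "tail_subset k A S" by (simp add: tail_subset_def)
  qed (use assms in \<open>auto simp: tail_subset_def\<close>)
  ultimately show ?thesis
    using assms by (auto simp: tail_equiv_def block_from_def)
qed

lemma tail_equiv_swapcols:
  assumes "block_from k A" and "k \<le> j" and "j < dim_col A" and "k \<le> l" and "l < dim_col A"
  shows "tail_equiv k A (swapcols j l A)"
proof (cases "j = l")
  case True
  then have "swapcols j l A = A" by (intro eq_matI) auto
  then show ?thesis by (simp add: tail_equiv_refl)
next
  case False
  have "row_col_equiv lscale rscale A (swapcols j l A)"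
    unfolding row_col_equiv_def using assms False by (blast intro: elementary_step.EC2)
  moreover have "tail_subset k (swapcols j l A) S = tail_subset k A S" for S
  proof
    assume B: "tail_subset k (swapcols j l A) S"
    have "A $$ (p,q) \<in> S" if "k \<le> p" "p < dim_row A" "k \<le> q" "q < dim_col A" for p q
    proof -
      define q' where "q' = (if q = j then l else if q = l then j else q)"
      have "swapcols j l A $$ (p,q') \<in> S"
        using B that assms by (simp add: tail_subset_def q'_def)
      then show ?thesis using that assms by (auto simp: q'_def split: if_splits)
    qed
    then show "tail_subset k A S" by (simp add: tail_subset_def)
  qed (use assms in \<open>auto simp: tail_subset_def\<close>)
  ultimately show ?thesis
    using assms by (auto simp: tail_equiv_def block_from_def)
qed

end

subsection \<open>Clearing the row and column of a minimal pivot\<close>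

context euclidean_bimodule
begin

text \<open>Minimality is over all matrices reachable by \<open>tail_equiv\<close>, not only over
  the entries of \<open>A\<close>, so it also applies to remainders that appear after further
  operations. As the values are only partially ordered, it says that none is strictly
  smaller.\<close>

definition minimal_pivot :: "nat \<Rightarrow> 'e mat \<Rightarrow> bool" where
  "minimal_pivot k A \<longleftrightarrow> block_from k A \<and> k < dim_row A \<and> k < dim_col A \<and> A $$ (k,k) \<noteq> 0 \<and>
    (\<forall>C i j. tail_equiv k A C \<and> k \<le> i \<and> i < dim_row C \<and> k \<le> j \<and> j < dim_col C \<and> C $$ (i,j) \<noteq> 0 \<longrightarrow>
      \<not> d (C $$ (i,j)) < d (A $$ (k,k)))"

lemma minimal_pivotD:
  assumes "minimal_pivot k A"
  shows "block_from k A" and "k < dim_row A" and "k < dim_col A" and "A $$ (k,k) \<noteq> 0"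
  using assms by (auto simp: minimal_pivot_def)

lemma minimal_pivot_minimal:
  "minimal_pivot k A \<Longrightarrow> tail_equiv k A C \<Longrightarrow> k \<le> i \<Longrightarrow> i < dim_row C \<Longrightarrow> k \<le> j \<Longrightarrow> j < dim_col C \<Longrightarrow>
    C $$ (i,j) \<noteq> 0 \<Longrightarrow> \<not> d (C $$ (i,j)) < d (A $$ (k,k))"
  by (simp add: minimal_pivot_def)

text \<open>Whatever is reachable from \<open>B\<close> is reachable from \<open>A\<close>, so
  minimality survives every operation that keeps the pivot.\<close>

lemma minimal_pivot_tail_equiv:
  assumes "minimal_pivot k A" and "tail_equiv k A B" and "B $$ (k,k) = A $$ (k,k)"
  shows "minimal_pivot k B"
  unfolding minimal_pivot_def
proof (intro conjI allI impI)
  show "block_from k B" using assms minimal_pivotD tail_equiv_block_from by blast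
  show "k < dim_row B" "k < dim_col B" "B $$ (k,k) \<noteq> 0"
    using assms minimal_pivotD[OF assms(1)] by (simp_all add: tail_equiv_dim)
next
  fix C i j
  assume C: "tail_equiv k B C \<and> k \<le> i \<and> i < dim_row C \<and> k \<le> j \<and> j < dim_col C \<and> C $$ (i,j) \<noteq> 0"
  then show "\<not> d (C $$ (i,j)) < d (B $$ (k,k))"
    using minimal_pivot_minimal[OF assms(1) tail_equiv_trans[OF assms(2)]] assms(3) by simp
qed

lemma exists_minimal_pivot:
  assumes "block_from k A" and "\<not> tail_subset k A {0}"
  shows "\<exists>B. tail_equiv k A B \<and> minimal_pivot k B"
proof -
  define X where "X = {C $$ (i,j) | C i j. tail_equiv k A C \<and> k \<le> i \<and> i < dim_row A \<and>
    k \<le> j \<and> j < dim_col A \<and> C $$ (i,j) \<noteq> 0}"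
  have "X \<noteq> {}"
    using assms(2) tail_equiv_refl[of k A] unfolding X_def tail_subset_def by blast
  moreover have "X \<subseteq> - {0}" by (auto simp: X_def)
  ultimately obtain b where b: "b \<in> X" "\<forall>y\<in>X. \<not> d y < d b"
    using artinian_on_minimal[OF artinian_left] by blast
  then obtain C i j where C: "tail_equiv k A C" "k \<le> i" "i < dim_row A" "k \<le> j" "j < dim_col A"
      "C $$ (i,j) = b" "b \<noteq> 0"
    by (auto simp: X_def)
  \<comment> \<open>The row swap brings the chosen entry to \<open>(k,j)\<close>, the column swap
    then to \<open>(k,k)\<close>.\<close>
  let ?C1 = "swaprows i k C" and ?B = "swapcols j k (swaprows i k C)"
  have dim: "dim_row C = dim_row A" "dim_col C = dim_col A"
    using C by (simp_all add: tail_equiv_dim)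
  have 1: "tail_equiv k C ?C1"
    by (rule tail_equiv_swaprows) (use C dim assms(1) tail_equiv_block_from in auto)
  then have 2: "tail_equiv k A ?C1" using C tail_equiv_trans by blast
  have "tail_equiv k ?C1 ?B"
    by (rule tail_equiv_swapcols) (use C 2 dim assms(1) tail_equiv_block_from in auto)
  with 2 have B: "tail_equiv k A ?B" using tail_equiv_trans by blast
  have Bkk: "?B $$ (k,k) = b" using C dim by auto
  have "minimal_pivot k ?B"
    unfolding minimal_pivot_def
  proof (intro conjI allI impI)
    show "block_from k ?B" using B assms(1) tail_equiv_block_from by blast
    show "k < dim_row ?B" "k < dim_col ?B" using C dim by auto
    show "?B $$ (k,k) \<noteq> 0" using Bkk C by simp
  next
    fix D p q
    assume D: "tail_equiv k ?B D \<and> k \<le> p \<and> p < dim_row D \<and> k \<le> q \<and> q < dim_col D \<and> D $$ (p,q) \<noteq> 0"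
    \<comment> \<open>Entries of matrices reachable from \<open>?B\<close> already competed in
      \<open>X\<close>.\<close>
    then have "tail_equiv k A D" using B tail_equiv_trans by blast
    with D have "D $$ (p,q) \<in> X" by (auto simp: X_def tail_equiv_dim)
    then show "\<not> d (D $$ (p,q)) < d (?B $$ (k,k))" using b Bkk by simp
  qed
  with B show ?thesis by blast
qed

lemma minimal_pivot_dvd_col:
  assumes "minimal_pivot k A" and "k < i" and "i < dim_row A"
  shows "\<exists>c. A $$ (i,k) = lscale c (A $$ (k,k))"
\<comment> \<open>Division is only available for a nonzero dividend; a zero entry is the multiple by
  0.\<close>
proof (cases "A $$ (i,k) = 0")
  case True
  then show ?thesis by (metis lscale_zero_left)
next
  case False
  note A = minimal_pivotD[OF assms(1)]
  from division_left[OF False A(4)] obtain c r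
    where cr: "A $$ (i,k) = lscale c (A $$ (k,k)) + r" "r = 0 \<or> d r < d (A $$ (k,k))" by blast
  \<comment> \<open>Subtracting \<open>c\<close> times the pivot row leaves the remainder
    \<open>r\<close> at \<open>(i,k)\<close> of a reachable matrix; were \<open>r\<close> nonzero,
    its smaller value would contradict minimality.\<close>
  obtain B where B: "tail_equiv k A B" "dim_row B = dim_row A" "dim_col B = dim_col A"
    "\<And>p q. p < dim_row A \<Longrightarrow> q < dim_col A \<Longrightarrow>
      B $$ (p,q) = (if p = i then A $$ (i,q) + lscale (- c) (A $$ (k,q)) else A $$ (p,q))"
    using tail_equiv_add_row[OF A(1) _ assms(3) order_refl A(2), of "- c"] assms(2)
    by (metis less_imp_le less_irrefl)
  have "B $$ (i,k) = r" using B(4) assms A cr by (simp add: lscale_minus_left)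
  then have "r = 0"
    using minimal_pivot_minimal[OF assms(1) B(1), of i k] B(2,3) assms A(2,3) cr(2) by force
  then show ?thesis using cr by auto
qed

text \<open>Mirror image of the column case: column operations use scalars on the right, hence right
  division by the same function \<open>d\<close>.\<close>

lemma minimal_pivot_dvd_row:
  assumes "minimal_pivot k A" and "k < j" and "j < dim_col A"
  shows "\<exists>c. A $$ (k,j) = rscale (A $$ (k,k)) c"
proof (cases "A $$ (k,j) = 0")
  case True
  then show ?thesis by (metis rscale_zero_right)
next
  case False
  note A = minimal_pivotD[OF assms(1)]
  from division_right[OF False A(4)] obtain c r
    where cr: "A $$ (k,j) = rscale (A $$ (k,k)) c + r" "r = 0 \<or> d r < d (A $$ (k,k))" by blast
  obtain B where B: "tail_equiv k A B" "dim_row B = dim_row A" "dim_col B = dim_col A"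
    "\<And>p q. p < dim_row A \<Longrightarrow> q < dim_col A \<Longrightarrow>
      B $$ (p,q) = (if q = j then A $$ (p,j) + rscale (A $$ (p,k)) (- c) else A $$ (p,q))"
    using tail_equiv_add_col[OF A(1) _ assms(3) order_refl A(3), of "- c"] assms(2)
    by (metis less_imp_le less_irrefl)
  have "B $$ (k,j) = r" using B(4) assms A cr by (simp add: rscale_minus_right)
  then have "r = 0"
    using minimal_pivot_minimal[OF assms(1) B(1), of k j] B(2,3) assms A(2,3) cr(2) by force
  then show ?thesis using cr by auto
qed

text \<open>Rows are cleared one at a time. Each step keeps the pivot, so it remains minimal and the
  next division is again exact.\<close>

lemma clear_col:
  assumes "minimal_pivot k A" and "p \<le> dim_row A"
  shows "\<exists>B. tail_equiv k A B \<and> B $$ (k,k) = A $$ (k,k) \<and> (\<forall>i. k < i \<and> i < p \<longrightarrow> B $$ (i,k) = 0)"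
  using assms(2)
proof (induction p)
  case 0
  then show ?case using tail_equiv_refl by auto
next
  case (Suc p)
  then obtain B where B: "tail_equiv k A B" "B $$ (k,k) = A $$ (k,k)"
    "\<forall>i. k < i \<and> i < p \<longrightarrow> B $$ (i,k) = 0" by auto
  have dim: "dim_row B = dim_row A" "dim_col B = dim_col A" using B by (simp_all add: tail_equiv_dim)
  have mp: "minimal_pivot k B" using minimal_pivot_tail_equiv[OF assms(1)] B by blast
  note B' = minimal_pivotD[OF mp]
  show ?case
  \<comment> \<open>For \<open>p \<le> k\<close> row \<open>p\<close> is not below the pivot and
    nothing has to be done.\<close>
  proof (cases "k < p")
    case True
    obtain c where c: "B $$ (p,k) = lscale c (B $$ (k,k))"
      using minimal_pivot_dvd_col[OF mp True] Suc.prems dim by auto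
    obtain C where C: "tail_equiv k B C"
      "\<And>i j. i < dim_row B \<Longrightarrow> j < dim_col B \<Longrightarrow>
        C $$ (i,j) = (if i = p then B $$ (p,j) + lscale (- c) (B $$ (k,j)) else B $$ (i,j))"
      using tail_equiv_add_row[OF B'(1) _ _ order_refl B'(2), of p "- c"] True Suc.prems dim
      by (metis Suc_le_lessD less_imp_le less_irrefl)
    have "C $$ (i,k) = 0" if "k < i" "i < Suc p" for i
      using that C(2)[of i k] B' B(3) c Suc.prems dim by (auto simp: lscale_minus_left)
    moreover have "C $$ (k,k) = A $$ (k,k)" using C(2) B' B(2) True by simp
    ultimately show ?thesis using tail_equiv_trans[OF B(1) C(1)] by blast
  next
    case False
    with B show ?thesis by (intro exI[of _ B]) (auto simp: less_Suc_eq)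
  qed
qed

text \<open>Adding multiples of column \<open>k\<close> to later columns leaves column
  \<open>k\<close> alone, so the zeros below the pivot persist.\<close>

lemma clear_row:
  assumes "minimal_pivot k A" and "p \<le> dim_col A"
    and "\<forall>i. k < i \<and> i < dim_row A \<longrightarrow> A $$ (i,k) = 0"
  shows "\<exists>B. tail_equiv k A B \<and> B $$ (k,k) = A $$ (k,k) \<and>
    (\<forall>i. k < i \<and> i < dim_row A \<longrightarrow> B $$ (i,k) = 0) \<and> (\<forall>j. k < j \<and> j < p \<longrightarrow> B $$ (k,j) = 0)"
  using assms(2)
proof (induction p)
  case 0
  then show ?case using tail_equiv_refl assms(3) by auto
next
  case (Suc p)
  then obtain B where B: "tail_equiv k A B" "B $$ (k,k) = A $$ (k,k)"
    "\<forall>i. k < i \<and> i < dim_row A \<longrightarrow> B $$ (i,k) = 0"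
    "\<forall>j. k < j \<and> j < p \<longrightarrow> B $$ (k,j) = 0" by auto
  have dim: "dim_row B = dim_row A" "dim_col B = dim_col A" using B by (simp_all add: tail_equiv_dim)
  have mp: "minimal_pivot k B" using minimal_pivot_tail_equiv[OF assms(1)] B by blast
  note B' = minimal_pivotD[OF mp]
  show ?case
  proof (cases "k < p")
    case True
    obtain c where c: "B $$ (k,p) = rscale (B $$ (k,k)) c"
      using minimal_pivot_dvd_row[OF mp True] Suc.prems dim by auto
    obtain C where C: "tail_equiv k B C"
      "\<And>i j. i < dim_row B \<Longrightarrow> j < dim_col B \<Longrightarrow>
        C $$ (i,j) = (if j = p then B $$ (i,p) + rscale (B $$ (i,k)) (- c) else B $$ (i,j))"
      using tail_equiv_add_col[OF B'(1) _ _ order_refl B'(3), of p "- c"] True Suc.prems dim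
      by (metis Suc_le_lessD less_imp_le less_irrefl)
    have "C $$ (k,j) = 0" if "k < j" "j < Suc p" for j
      using that C(2)[of k j] B' B(4) c Suc.prems dim by (auto simp: rscale_minus_right)
    moreover have "C $$ (i,k) = B $$ (i,k)" if "i < dim_row A" for i
      using that C(2) B' True dim by simp
    ultimately show ?thesis using tail_equiv_trans[OF B(1) C(1)] B B'(2) dim
      by (intro exI[of _ C]) auto
  next
    case False
    with B show ?thesis by (intro exI[of _ B]) (auto simp: less_Suc_eq)
  qed
qed

lemma minimal_pivot_dvd_tail:
  assumes "minimal_pivot k A" and "\<forall>i. k < i \<and> i < dim_row A \<longrightarrow> A $$ (i,k) = 0"
    and "\<forall>j. k < j \<and> j < dim_col A \<longrightarrow> A $$ (k,j) = 0"
  shows "tail_subset k A (bispan lscale rscale (A $$ (k,k)))"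
  unfolding tail_subset_def
proof (intro allI impI)
  fix i j assume ij: "k \<le> i \<and> i < dim_row A \<and> k \<le> j \<and> j < dim_col A"
  let ?S = "bispan lscale rscale (A $$ (k,k))"
  note A = minimal_pivotD[OF assms(1)]
  consider "i = k" "j = k" | "i = k" "k < j" | "k < i" "j = k" | "k < i" "k < j"
    using ij by linarith
  then show "A $$ (i,j) \<in> ?S"
  proof cases
    case 4
    \<comment> \<open>Row \<open>i\<close> is added to the pivot row. As \<open>A $$ (i,k)\<close>
      is zero the pivot stays, and as \<open>A $$ (k,j)\<close> is zero the entry at
      \<open>(i,j)\<close> is copied into the pivot row, where divisibility is known.\<close>
    obtain B where B: "tail_equiv k A B" "dim_col B = dim_col A"
      "\<And>p q. p < dim_row A \<Longrightarrow> q < dim_col A \<Longrightarrow>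
        B $$ (p,q) = (if p = k then A $$ (k,q) + lscale 1 (A $$ (i,q)) else A $$ (p,q))"
      using tail_equiv_add_row[OF A(1) order_refl A(2), of i 1] ij 4 by (metis less_irrefl)
    have eq: "B $$ (k,k) = A $$ (k,k)" "B $$ (k,j) = A $$ (i,j)"
      using B(3) A assms ij 4 by (simp_all add: lscale_one)
    then have "minimal_pivot k B" using minimal_pivot_tail_equiv assms(1) B(1) by blast
    then obtain c where "A $$ (i,j) = rscale (A $$ (k,k)) c"
      using minimal_pivot_dvd_row[of k B j] 4 ij B(2) eq by auto
    then show ?thesis
      using bispan_self subbimodule_bispan subbimodule_rscale by metis
  qed (use assms ij bispan_self subbimodule_zero[OF subbimodule_bispan] in auto)
qed

section \<open>Recursion on the lower right block\<close>

lemma pivot_step: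
  assumes "block_from k A" and "\<not> tail_subset k A {0}"
  shows "\<exists>B. tail_equiv k A B \<and> k < dim_row A \<and> k < dim_col A \<and> block_from (Suc k) B \<and>
    B $$ (k,k) \<noteq> 0 \<and> tail_subset k B (bispan lscale rscale (B $$ (k,k)))"
proof -
  obtain B where B: "tail_equiv k A B" "minimal_pivot k B"
    using exists_minimal_pivot[OF assms] by blast
  obtain C where C: "tail_equiv k B C" "C $$ (k,k) = B $$ (k,k)"
      "\<forall>i. k < i \<and> i < dim_row B \<longrightarrow> C $$ (i,k) = 0"
    using clear_col[OF B(2) order_refl] by blast
  have C': "minimal_pivot k C" using minimal_pivot_tail_equiv[OF B(2)] C by blast
  obtain D where D: "tail_equiv k C D" "D $$ (k,k) = C $$ (k,k)"
      "\<forall>i. k < i \<and> i < dim_row C \<longrightarrow> D $$ (i,k) = 0"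
      "\<forall>j. k < j \<and> j < dim_col C \<longrightarrow> D $$ (k,j) = 0"
    using clear_row[OF C' order_refl] C by (auto simp: tail_equiv_dim)
  have D': "minimal_pivot k D" using minimal_pivot_tail_equiv[OF C'] D by blast
  note D'' = minimal_pivotD[OF D']
  have dim: "dim_row C = dim_row D" "dim_col C = dim_col D"
    using D by (simp_all add: tail_equiv_dim)
  have AD: "tail_equiv k A D" using B C D tail_equiv_trans by blast
  have "block_from (Suc k) D"
    using D''(1) D(3,4) dim unfolding block_from_def
    by (metis less_Suc_eq nat_neq_iff)
  moreover have "tail_subset k D (bispan lscale rscale (D $$ (k,k)))"
    by (rule minimal_pivot_dvd_tail[OF D']) (use D dim in auto)
  ultimately show ?thesis using AD D'' by (auto simp: tail_equiv_dim intro!: exI[of _ D])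
qed

text \<open>The unchanged entries outside the block preserve earlier pivots. The last clause says
  that the new pivot generates the same sub-bimodule as the block of \<open>A\<close>; it gives the
  inclusion in the previous pivot's sub-bimodule and, for \<open>k = 0\<close>, the value of
  \<open>Nb\<close>.\<close>

lemma diagonalization_from:
  assumes "block_from k A" and "\<not> tail_subset k A {0}"
  shows "\<exists>B s. row_col_equiv lscale rscale A B \<and>
    dim_row B = dim_row A \<and> dim_col B = dim_col A \<and>
    (\<forall>i<dim_row A. \<forall>j<dim_col A. i < k \<or> j < k \<longrightarrow> B $$ (i,j) = A $$ (i,j)) \<and>
    k < s \<and> s \<le> min (dim_row A) (dim_col A) \<and>
    block_from s B \<and> tail_subset s B {0} \<and>
    (\<forall>i\<ge>k. Suc i < s \<longrightarrow> B $$ (Suc i, Suc i) \<in> bispan lscale rscale (B $$ (i,i))) \<and>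
    B $$ (s - 1, s - 1) \<noteq> 0 \<and>
    (\<forall>S. subbimodule lscale rscale S \<longrightarrow> (tail_subset k A S \<longleftrightarrow> B $$ (k,k) \<in> S))"
  using assms
proof (induction "dim_row A - k" arbitrary: k A rule: less_induct)
  case less
  obtain B where B: "tail_equiv k A B" "k < dim_row A" "k < dim_col A" "block_from (Suc k) B"
      "B $$ (k,k) \<noteq> 0" and tail: "tail_subset k B (bispan lscale rscale (B $$ (k,k)))"
    using pivot_step[OF less.prems] by blast
  have dim: "dim_row B = dim_row A" "dim_col B = dim_col A" using B by (simp_all add: tail_equiv_dim)
  have AB: "row_col_equiv lscale rscale A B"
    "\<And>i j. i < dim_row A \<Longrightarrow> j < dim_col A \<Longrightarrow> i < k \<or> j < k \<Longrightarrow> B $$ (i,j) = A $$ (i,j)"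
    using B(1) unfolding tail_equiv_def by blast+
  have iff: "tail_subset k A S \<longleftrightarrow> B $$ (k,k) \<in> S" if S: "subbimodule lscale rscale S" for S
  proof -
    have "tail_subset k A S \<longleftrightarrow> tail_subset k B S" using B(1) S by (simp add: tail_equiv_def)
    also have "\<dots> \<longleftrightarrow> B $$ (k,k) \<in> S"
    proof
      \<comment> \<open>\<open>S\<close> contains the sub-bimodule generated by the corner, hence
        the whole block.\<close>
      assume "B $$ (k,k) \<in> S"
      then show "tail_subset k B S"
        using tail bispan_subset_iff[OF S] unfolding tail_subset_def by blast
    qed (use B dim in \<open>simp add: tail_subset_def\<close>)
    finally show ?thesis .
  qed
  show ?case
  proof (cases "tail_subset (Suc k) B {0}")
    \<comment> \<open>Nothing is left after this pivot, so \<open>s = Suc k\<close> and the chain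
      condition is vacuous.\<close>
    case True
    then show ?thesis
      using AB dim B iff by (intro exI[of _ B] exI[of _ "Suc k"]) auto
  next
    case False
    \<comment> \<open>The number of rows in the block drops because the pivot lies inside the
      matrix.\<close>
    have "dim_row B - Suc k < dim_row A - k" using B(2) dim by simp
    note IH = less.hyps[OF this B(4) False]
    obtain C s where C: "row_col_equiv lscale rscale B C" "dim_row C = dim_row B" "dim_col C = dim_col B"
      "\<forall>i<dim_row B. \<forall>j<dim_col B. i < Suc k \<or> j < Suc k \<longrightarrow> C $$ (i,j) = B $$ (i,j)"
      "Suc k < s" "s \<le> min (dim_row B) (dim_col B)" "block_from s C" "tail_subset s C {0}"
      "\<forall>i\<ge>Suc k. Suc i < s \<longrightarrow> C $$ (Suc i, Suc i) \<in> bispan lscale rscale (C $$ (i,i))"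
      "C $$ (s - 1, s - 1) \<noteq> 0"
      "\<And>S. subbimodule lscale rscale S \<Longrightarrow> tail_subset (Suc k) B S \<longleftrightarrow> C $$ (Suc k, Suc k) \<in> S"
      using IH by blast
    have Ckk: "C $$ (k,k) = B $$ (k,k)" using C(4) B dim by simp
    \<comment> \<open>The remaining block lies in the sub-bimodule generated by the current pivot;
      the last clause of the induction hypothesis, taken for this sub-bimodule, puts the next pivot
      there too.\<close>
    have "tail_subset (Suc k) B (bispan lscale rscale (B $$ (k,k)))"
      using tail by (auto simp: tail_subset_def)
    then have Sk: "C $$ (Suc k, Suc k) \<in> bispan lscale rscale (C $$ (k,k))"
      using C(11)[OF subbimodule_bispan] Ckk by simp
    have "\<forall>i\<ge>k. Suc i < s \<longrightarrow> C $$ (Suc i, Suc i) \<in> bispan lscale rscale (C $$ (i,i))"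
      using C(9) Sk by (metis le_neq_implies_less Suc_leI)
    moreover have "row_col_equiv lscale rscale A C"
      using AB(1) C(1) unfolding row_col_equiv_def by (rule rtranclp_trans)
    ultimately show ?thesis
      using AB(2) C dim iff Ckk by (intro exI[of _ C] exI[of _ s]) auto
  qed
qed

end

section \<open>The diagonal form as the case \<open>k = 0\<close> of the recursion\<close>

theorem theorem1p8:
  fixes lscale :: "'r::{ring,monoid_mult} \<Rightarrow> 'e::ab_group_add \<Rightarrow> 'e"
    and rscale :: "'e \<Rightarrow> 'r \<Rightarrow> 'e"
    and d :: "'e \<Rightarrow> 'p::order"
    and A :: "'e mat"
    and m n :: nat
  assumes "euclidean_bimodule lscale rscale d"
    and "m \<ge> 2" and "n \<ge> 2"
    and "A \<in> carrier_mat m n" and "A \<noteq> 0\<^sub>m m n"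
  shows "\<exists>B s. B \<in> carrier_mat m n \<and> row_col_equiv lscale rscale A B \<and>
    1 \<le> s \<and> s \<le> min m n \<and>
    (\<forall>i<m. \<forall>j<n. \<not> (i = j \<and> i < s) \<longrightarrow> B $$ (i,j) = 0) \<and>
    Nb lscale rscale A = bispan lscale rscale (B $$ (0,0)) \<and>
    (\<forall>i. Suc i < s \<longrightarrow>
      bispan lscale rscale (B $$ (Suc i, Suc i)) \<subseteq> bispan lscale rscale (B $$ (i,i))) \<and>
    bispan lscale rscale (B $$ (s - 1, s - 1)) \<noteq> {0}"
proof -
  interpret euclidean_bimodule lscale rscale d by (rule assms(1))
  have dimA: "dim_row A = m" "dim_col A = n" using assms(4) by auto
  have "block_from 0 A" by (simp add: block_from_def)
  moreover have "\<not> tail_subset 0 A {0}"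
    using assms(4,5) by (auto simp: tail_subset_def intro!: eq_matI)
  ultimately obtain B s where B: "row_col_equiv lscale rscale A B" "dim_row B = m" "dim_col B = n"
      "0 < s" "s \<le> min m n" "block_from s B" "tail_subset s B {0}"
      "\<forall>i. Suc i < s \<longrightarrow> B $$ (Suc i, Suc i) \<in> bispan lscale rscale (B $$ (i,i))"
      "B $$ (s - 1, s - 1) \<noteq> 0"
      "\<And>S. subbimodule lscale rscale S \<Longrightarrow> tail_subset 0 A S \<longleftrightarrow> B $$ (0,0) \<in> S"
    using diagonalization_from[of 0 A] dimA by auto
  have Nb: "Nb lscale rscale A \<subseteq> S \<longleftrightarrow> bispan lscale rscale (B $$ (0,0)) \<subseteq> S"
    if "subbimodule lscale rscale S" for S
    using B(10)[OF that] by (auto simp: Nb_subset_iff bispan_subset_iff that tail_subset_def dimA)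
  \<comment> \<open>Both sides are sub-bimodules contained in the same sub-bimodules, so each
    contains the other.\<close>
  have "Nb lscale rscale A = bispan lscale rscale (B $$ (0,0))"
    using Nb[OF subbimodule_Nb] Nb[OF subbimodule_bispan] by blast
  \<comment> \<open>Either the position is off the diagonal and meets the first \<open>s\<close>
    rows or columns, or it lies in the vanishing block from \<open>s\<close> on.\<close>
  moreover have "B $$ (i,j) = 0" if "i < m" "j < n" "\<not> (i = j \<and> i < s)" for i j
    using B(2,3,6,7) that unfolding block_from_def tail_subset_def
    by (metis not_less singletonD)
  moreover have "bispan lscale rscale (B $$ (s - 1, s - 1)) \<noteq> {0}"
    using bispan_self B(9) by blast
  ultimately show ?thesis
    using B by (intro exI[of _ B] exI[of _ s])
      (auto simp: bispan_subset_iff subbimodule_bispan intro!: carrier_matI)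
qed

end
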